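(* Let $\Theta\in \mathrm{M}_n(\mathbb{R})$ be skew-symmetric and let $(A_1,\ldots,A_n)$ be a $\Theta$-Weyl tuple on a Banach space $X$. Then for all $t=(t_1,\ldots,t_n)$ and $s=(s_1,\ldots,s_n)$ in $\mathbb{R}^n$, $$e^{it\cdot A}\circ e^{is\cdot A}=e^{\frac12 i\langle t,\Theta s\rangle}\,e^{i(t+s)\cdot A}.$$ Moreover, the map $\mathbb{R}^n\to \mathrm{B}(X)$, $t\mapsto e^{it\cdot A}$ is continuous when $\mathrm{B}(X)$ is equipped with the strong operator topology.
   Context: A $\Theta$-Weyl tuple on a Banach space $X$ is a tuple $(A_1,\ldots,A_n)$ of operators such that each $iA_k$ generates a bounded strongly continuous group $(e^{itA_k})_{t\in\mathbb{R}}$ on $X$ and $e^{itA_j}e^{isA_k}=e^{i\Theta_{jk}ts}e^{isA_k}e^{itA_j}$ for all $j,k\in\{1,\ldots,n\}$ and $s,t\in\mathbb{R}$. Let $(\Theta^\uparrow)_{jk}=\Theta_{jk}$ if $j\leq k$ and $0$ otherwise. For $t\in\mathbb{R}^n$, $$e^{it\cdot A}:=e^{-\frac12 i\langle t,\Theta^\uparrow t\rangle}\,e^{it_1A_1}e^{it_2A_2}\cdots e^{it_nA_n}.$$ *)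

theory Defs
  imports "HOL-Analysis.Analysis"
begin

class complex_normed_vector = real_normed_vector +
  fixes scaleC :: "complex \<Rightarrow> 'a \<Rightarrow> 'a"  (infixr "*\<^sub>C" 75)
  assumes scaleC_add_right: "a *\<^sub>C (x + y) = a *\<^sub>C x + a *\<^sub>C y"
    and scaleC_add_left: "(a + b) *\<^sub>C x = a *\<^sub>C x + b *\<^sub>C x"
    and scaleC_scaleC: "a *\<^sub>C b *\<^sub>C x = (a * b) *\<^sub>C x"
    and scaleC_of_real: "complex_of_real r *\<^sub>C x = r *\<^sub>R x"
    and norm_scaleC: "norm (a *\<^sub>C x) = cmod a * norm x"

class complex_banach = complex_normed_vector + banach

lemma scaleC_one [simp]: "1 *\<^sub>C x = (x :: 'a::complex_normed_vector)"
  using scaleC_of_real[of 1 x] by simp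

lemma bounded_linear_scaleC: "bounded_linear ((*\<^sub>C) a :: 'a::complex_normed_vector \<Rightarrow> 'a)"
proof (rule bounded_linear_intro[where K = "cmod a"])
  fix r and x :: 'a
  show "a *\<^sub>C r *\<^sub>R x = r *\<^sub>R a *\<^sub>C x"
    by (simp add: scaleC_of_real[symmetric] scaleC_scaleC mult.commute)
qed (simp_all add: scaleC_add_right norm_scaleC mult.commute)

instantiation complex :: complex_banach
begin

definition scaleC_complex :: "complex \<Rightarrow> complex \<Rightarrow> complex" where
  "scaleC_complex = (*)"

instance
  by standard (simp_all add: scaleC_complex_def algebra_simps norm_mult scaleR_conv_of_real)

end

instantiation blinfun :: (real_normed_vector, complex_normed_vector) complex_normed_vector
begin

lift_definition scaleC_blinfun :: "complex \<Rightarrow> 'a \<Rightarrow>\<^sub>L 'b \<Rightarrow> 'a \<Rightarrow>\<^sub>L 'b" is "\<lambda>a f x. a *\<^sub>C f x"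
  by (rule bounded_linear_compose[OF bounded_linear_scaleC])

instance
proof
  fix a b :: complex and r :: real and f g :: "'a \<Rightarrow>\<^sub>L 'b"
  show "a *\<^sub>C (f + g) = a *\<^sub>C f + a *\<^sub>C g"
    by transfer (simp add: scaleC_add_right)
  show "(a + b) *\<^sub>C f = a *\<^sub>C f + b *\<^sub>C f"
    by transfer (simp add: scaleC_add_left)
  show "a *\<^sub>C b *\<^sub>C f = (a * b) *\<^sub>C f"
    by transfer (simp add: scaleC_scaleC)
  show "complex_of_real r *\<^sub>C f = r *\<^sub>R f"
    by transfer (simp add: scaleC_of_real)
  show "norm (a *\<^sub>C f) = cmod a * norm f"
  proof (rule antisym)
    have le: "norm (c *\<^sub>C h) \<le> cmod c * norm h" for c and h :: "'a \<Rightarrow>\<^sub>L 'b"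
    proof (rule norm_blinfun_bound)
      fix x
      have "norm (blinfun_apply h x) \<le> norm h * norm x"
        by (rule norm_blinfun)
      then show "norm (blinfun_apply (c *\<^sub>C h) x) \<le> cmod c * norm h * norm x"
        by (simp add: scaleC_blinfun.rep_eq norm_scaleC mult_left_mono mult.assoc)
    qed simp
    show "norm (a *\<^sub>C f) \<le> cmod a * norm f"
      by (rule le)
    show "cmod a * norm f \<le> norm (a *\<^sub>C f)"
    proof (cases "a = 0")
      case False
      have "inverse a *\<^sub>C a *\<^sub>C f = f"
        using False by transfer (simp add: scaleC_scaleC)
      then have "norm f \<le> cmod (inverse a) * norm (a *\<^sub>C f)"
        using le[of "inverse a" "a *\<^sub>C f"] by simp
      then have "cmod a * norm f \<le> cmod a * (cmod (inverse a) * norm (a *\<^sub>C f))"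
        by (rule mult_left_mono) simp
      also have "\<dots> = norm (a *\<^sub>C f)"
        using False by (simp add: norm_inverse)
      finally show ?thesis .
    qed simp
  qed
qed

end

text \<open>
  The library operators \<open>'a \<Rightarrow>\<^sub>L 'a\<close> are only real-linear; \<open>bounded_ops\<close> is the set \<open>B(X)\<close> of the
  complex-linear ones, and \<open>sot\<close> is the strong operator topology on it.
\<close>

definition bounded_ops :: "('a::complex_banach \<Rightarrow>\<^sub>L 'a) set" where
  "bounded_ops = {T. \<forall>c x. blinfun_apply T (c *\<^sub>C x) = c *\<^sub>C blinfun_apply T x}"

definition sot :: "('a::complex_banach \<Rightarrow>\<^sub>L 'a) topology" where
  "sot = subtopology strong_operator_topology bounded_ops"

definition bounded_C0_group :: "(real \<Rightarrow> 'a::complex_banach \<Rightarrow>\<^sub>L 'a) \<Rightarrow> bool" where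
  "bounded_C0_group U \<longleftrightarrow>
     U 0 = id_blinfun \<and> (\<forall>s t. U (s + t) = U s o\<^sub>L U t) \<and>
     continuous_map euclideanreal sot U \<and> bounded (range U)"

text \<open>Unbounded operators are represented by their graphs.\<close>

type_synonym 'a unbounded_op = "('a \<times> 'a) set"

definition generator :: "(real \<Rightarrow> 'a::complex_banach \<Rightarrow>\<^sub>L 'a) \<Rightarrow> 'a unbounded_op" where
  "generator U = {(x, y). ((\<lambda>h. (blinfun_apply (U h) x - x) /\<^sub>R h) \<longlongrightarrow> y) (at 0)}"

definition scale_op :: "complex \<Rightarrow> 'a::complex_banach unbounded_op \<Rightarrow> 'a unbounded_op" where
  "scale_op c A = {(x, c *\<^sub>C y) | x y. (x, y) \<in> A}"

definition generates ::
  "'a::complex_banach unbounded_op \<Rightarrow> (real \<Rightarrow> 'a \<Rightarrow>\<^sub>L 'a) \<Rightarrow> bool" where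
  "generates B U \<longleftrightarrow> bounded_C0_group U \<and> generator U = B"

text \<open>\<open>exp_i A t\<close> is \<open>e\<^bsup>itA\<^esup>\<close>; lemma \<open>generates_unique\<close> below shows that it is well defined.\<close>

definition exp_i :: "'a::complex_banach unbounded_op \<Rightarrow> real \<Rightarrow> 'a \<Rightarrow>\<^sub>L 'a" where
  "exp_i A = (THE U. generates (scale_op \<i> A) U)"

lemma has_vector_derivative_within_quotient:
  "(f has_vector_derivative d) (at p within S) \<longleftrightarrow>
     ((\<lambda>s. (f s - f p) /\<^sub>R (s - p)) \<longlongrightarrow> d) (at p within S)"
proof -
  have "norm (f s - f p - (s - p) *\<^sub>R d) / norm (s - p) = norm ((f s - f p) /\<^sub>R (s - p) - d)"
    if "s \<noteq> p" for s
  proof -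
    have "(f s - f p) /\<^sub>R (s - p) - d = (f s - f p - (s - p) *\<^sub>R d) /\<^sub>R (s - p)"
      using that by (simp add: scaleR_diff_right)
    then show ?thesis
      by (simp add: divide_inverse_commute)
  qed
  then have "((\<lambda>s. norm (f s - f p - (s - p) *\<^sub>R d) / norm (s - p)) \<longlongrightarrow> 0) (at p within S)
      \<longleftrightarrow> ((\<lambda>s. norm ((f s - f p) /\<^sub>R (s - p) - d)) \<longlongrightarrow> 0) (at p within S)"
    by (intro filterlim_cong refl) (simp add: eventually_at_filter)
  then show ?thesis
    unfolding has_vector_derivative_def has_derivative_iff_norm
    by (simp add: bounded_linear_scaleR_left tendsto_norm_zero_iff LIM_zero_iff)
qed

lemma has_vector_derivative_at_quotient:
  "(f has_vector_derivative d) (at p) \<longleftrightarrow> ((\<lambda>h. (f (p + h) - f p) /\<^sub>R h) \<longlongrightarrow> d) (at 0)"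
  unfolding has_vector_derivative_within_quotient
  using LIM_offset_zero_iff[of p "\<lambda>s. (f s - f p) /\<^sub>R (s - p)" d] by simp

lemma bounded_C0_group_inverse:
  assumes "bounded_C0_group U"
  shows "blinfun_apply (U (-t)) (blinfun_apply (U t) x) = x"
proof -
  have "U (-t) o\<^sub>L U t = id_blinfun"
    using assms unfolding bounded_C0_group_def by (metis add.left_inverse)
  then show ?thesis
    by (metis blinfun_apply_blinfun_compose blinfun_apply_id_blinfun id_apply)
qed

lemma bounded_C0_group_add:
  assumes "bounded_C0_group U"
  shows "blinfun_apply (U (s + t)) x = blinfun_apply (U s) (blinfun_apply (U t) x)"
  using assms by (simp add: bounded_C0_group_def)

lemma bounded_C0_group_continuous:
  assumes "bounded_C0_group U"
  shows "continuous_on S (\<lambda>t. blinfun_apply (U t) x)"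
proof -
  have "continuous_map euclideanreal strong_operator_topology U"
    using assms by (auto simp: bounded_C0_group_def sot_def continuous_map_in_subtopology)
  then have "continuous_on UNIV (\<lambda>t. blinfun_apply (U t) x)"
    by (simp add: continuous_on_strong_operator_topo_iff_coordinatewise)
  then show ?thesis
    using continuous_on_subset by blast
qed

lemma generator_iff:
  "(x, y) \<in> generator U \<longleftrightarrow> ((\<lambda>h. (blinfun_apply (U h) x - x) /\<^sub>R h) \<longlongrightarrow> y) (at 0)"
  by (simp add: generator_def)

lemma generator_invariant:
  assumes U: "bounded_C0_group U" and xy: "(x, y) \<in> generator U"
  shows "(blinfun_apply (U t) x, blinfun_apply (U t) y) \<in> generator U"
proof -
  have "blinfun_apply (U h) (blinfun_apply (U t) x) = blinfun_apply (U t) (blinfun_apply (U h) x)" for h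
    using bounded_C0_group_add[OF U, of h t x] bounded_C0_group_add[OF U, of t h x]
    by (simp add: add.commute)
  then have "(blinfun_apply (U h) (blinfun_apply (U t) x) - blinfun_apply (U t) x) /\<^sub>R h
      = blinfun_apply (U t) ((blinfun_apply (U h) x - x) /\<^sub>R h)" for h
    by (simp add: blinfun.diff_right blinfun.scaleR_right)
  moreover have "((\<lambda>h. blinfun_apply (U t) ((blinfun_apply (U h) x - x) /\<^sub>R h))
      \<longlongrightarrow> blinfun_apply (U t) y) (at 0)"
    using xy unfolding generator_iff by (intro blinfun.tendsto tendsto_const)
  ultimately show ?thesis
    by (simp add: generator_iff)
qed

lemma generator_agree:
  assumes U: "bounded_C0_group U" and V: "bounded_C0_group V"
    and eq: "generator U = generator V" and xy: "(x, y) \<in> generator V"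
  shows "blinfun_apply (U (-t)) (blinfun_apply (V t) x) = x"
proof -
  define W where "W t = blinfun_apply (U (-t)) (blinfun_apply (V t) x)" for t
  obtain M where M: "\<And>t. norm (U t) \<le> M"
    using U unfolding bounded_C0_group_def bounded_iff by auto
  have deriv: "(W has_vector_derivative 0) (at s)" for s
  proof -
    define z w where "z = blinfun_apply (V s) x" and "w = blinfun_apply (V s) y"
    have zw: "(z, w) \<in> generator V"
      unfolding z_def w_def by (rule generator_invariant[OF V xy])
    then have zw': "(z, w) \<in> generator U"
      by (simp add: eq)
    define d where "d h = (blinfun_apply (V h) z - z) /\<^sub>R h - (blinfun_apply (U h) z - z) /\<^sub>R h" for h
    have d: "(d \<longlongrightarrow> 0) (at 0)"
      using tendsto_diff[OF zw[unfolded generator_iff] zw'[unfolded generator_iff]]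
      by (simp add: d_def[abs_def])
    have quot: "(W (s + h) - W s) /\<^sub>R h = blinfun_apply (U (-(s + h))) (d h)" for h
    proof -
      have "W (s + h) = blinfun_apply (U (-(s + h))) (blinfun_apply (V h) z)"
        using bounded_C0_group_add[OF V, of h s x] by (simp add: W_def z_def add.commute)
      moreover have "W s = blinfun_apply (U (-(s + h))) (blinfun_apply (U h) z)"
        using bounded_C0_group_add[OF U, of "-(s + h)" h z] by (simp add: W_def z_def)
      ultimately show ?thesis
        by (simp add: d_def blinfun.diff_right blinfun.scaleR_right algebra_simps)
    qed
    have "((\<lambda>h. (W (s + h) - W s) /\<^sub>R h) \<longlongrightarrow> 0) (at 0)"
      unfolding quot
    proof (rule Lim_null_comparison)
      show "\<forall>\<^sub>F h in at 0. norm (blinfun_apply (U (-(s + h))) (d h)) \<le> M * norm (d h)"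
        by (intro always_eventually allI order_trans[OF norm_blinfun] mult_right_mono M) simp
      show "((\<lambda>h. M * norm (d h)) \<longlongrightarrow> 0) (at 0)"
        using tendsto_mult_right_zero[OF tendsto_norm_zero[OF d]] by simp
    qed
    then show ?thesis
      by (simp add: has_vector_derivative_at_quotient)
  qed
  have "(W has_derivative (\<lambda>h. 0)) (at s within UNIV)" for s
    using deriv[of s] by (simp add: has_vector_derivative_def)
  then have "\<exists>c. \<forall>s\<in>UNIV. W s = c"
    by (intro has_derivative_zero_constant) auto
  then have "W t = W 0"
    by auto
  also have "W 0 = x"
    using U V by (simp add: W_def bounded_C0_group_def)
  finally show ?thesis
    by (simp add: W_def)
qed

lemma generator_integral:
  assumes U: "bounded_C0_group U" and "a < b"
  shows "(integral {a..b} (\<lambda>s. blinfun_apply (U s) x), blinfun_apply (U b) x - blinfun_apply (U a) x)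
           \<in> generator U"
proof -
  define u where "u s = blinfun_apply (U s) x" for s
  define F where "F r = integral {a - 1..r} u" for r
  have cont: "continuous_on S u" for S
    unfolding u_def by (rule bounded_C0_group_continuous[OF U])
  have int: "u integrable_on {p..q}" for p q
    by (rule integrable_continuous_real[OF cont])
  have F_diff: "integral {p..q} u = F q - F p" if "a - 1 \<le> p" "p \<le> q" for p q
    using Henstock_Kurzweil_Integration.integral_combine[OF that int] by (simp add: F_def algebra_simps)
  have F_deriv: "((\<lambda>h. (F (p + h) - F p) /\<^sub>R h) \<longlongrightarrow> u p) (at 0)" if "a - 1 < p" for p
  proof -
    have "(F has_vector_derivative u p) (at p within {a - 1..p + 1})"
      unfolding F_def by (rule integral_has_vector_derivative[OF cont]) (use that in auto)
    then have "(F has_vector_derivative u p) (at p)"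
      using that by (simp add: at_within_Icc_at)
    then show ?thesis
      by (simp add: has_vector_derivative_at_quotient)
  qed
  have shift: "blinfun_apply (U h) (integral {a..b} u) = integral {a + h..b + h} u" for h
  proof -
    have "blinfun_apply (U h) (integral {a..b} u) = integral {a..b} (\<lambda>s. blinfun_apply (U h) (u s))"
      using integral_linear[OF int blinfun.bounded_linear_right, of a b "U h"] by (simp add: o_def)
    also have "\<dots> = integral {a..b} (\<lambda>s. u (s + h))"
      by (simp add: u_def bounded_C0_group_add[OF U, symmetric] add.commute)
    also have "\<dots> = integral {a + h..b + h} u"
      using integral_shift_real_ivl[of "a + h" h "b + h" u] by simp
    finally show ?thesis .
  qed
  have "((\<lambda>h. (F (b + h) - F b) /\<^sub>R h - (F (a + h) - F a) /\<^sub>R h) \<longlongrightarrow> u b - u a) (at 0)"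
    using \<open>a < b\<close> by (intro tendsto_diff F_deriv) auto
  then have "((\<lambda>h. (blinfun_apply (U h) (integral {a..b} u) - integral {a..b} u) /\<^sub>R h)
      \<longlongrightarrow> u b - u a) (at 0)"
  proof (rule Lim_transform_eventually)
    have "\<forall>\<^sub>F h :: real in at 0. h \<in> {-1<..<1}"
      by (rule eventually_at_in_open') auto
    then show "\<forall>\<^sub>F h in at 0. (F (b + h) - F b) /\<^sub>R h - (F (a + h) - F a) /\<^sub>R h
        = (blinfun_apply (U h) (integral {a..b} u) - integral {a..b} u) /\<^sub>R h"
    proof eventually_elim
      case (elim h)
      then have "integral {a + h..b + h} u = F (b + h) - F (a + h)"
        using \<open>a < b\<close> by (intro F_diff) auto
      moreover have "integral {a..b} u = F b - F a"
        using \<open>a < b\<close> by (intro F_diff) auto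
      ultimately show ?case
        unfolding shift by (simp only:) (simp add: algebra_simps)
    qed
  qed
  then show ?thesis
    unfolding generator_iff u_def .
qed

lemma generates_unique:
  assumes "generates B U" "generates B V"
  shows "U = V"
proof (rule ext, rule blinfun_eqI)
  fix t x
  have U: "bounded_C0_group U" and V: "bounded_C0_group V" and eq: "generator U = generator V"
    using assms by (auto simp: generates_def)
  define T where "T = U (-t) o\<^sub>L V t"
  define v where "v s = blinfun_apply (V s) x" for s
  define J where "J h = integral {0..h} v /\<^sub>R h" for h
  have fixed: "blinfun_apply T (J h) = J h" if "0 < h" for h
    using generator_agree[OF U V eq generator_integral[OF V that]]
    by (simp add: T_def J_def v_def[abs_def] blinfun.scaleR_right)
  have J: "(J \<longlongrightarrow> x) (at_right 0)"
  proof -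
    have "((\<lambda>r. integral {0..r} v) has_vector_derivative v 0) (at 0 within {0..1})"
      by (rule integral_has_vector_derivative)
        (auto simp: v_def[abs_def] intro: bounded_C0_group_continuous[OF V])
    then have "((\<lambda>h. integral {0..h} v /\<^sub>R h) \<longlongrightarrow> v 0) (at_right 0)"
      by (simp add: has_vector_derivative_within_quotient at_within_Icc_at_right)
    moreover have "v 0 = x"
      using V by (simp add: v_def bounded_C0_group_def)
    ultimately show ?thesis
      by (simp add: J_def[abs_def])
  qed
  have "((\<lambda>h. blinfun_apply T (J h)) \<longlongrightarrow> blinfun_apply T x) (at_right 0)"
    by (intro blinfun.tendsto tendsto_const J)
  moreover have "\<forall>\<^sub>F h in at_right 0. blinfun_apply T (J h) = J h"
    using eventually_at_right_less[of 0] by eventually_elim (rule fixed)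
  ultimately have "(J \<longlongrightarrow> blinfun_apply T x) (at_right 0)"
    by (rule Lim_transform_eventually)
  then have "blinfun_apply T x = x"
    using J by (intro tendsto_unique[of "at_right 0"]) auto
  then have "blinfun_apply (U t) (blinfun_apply T x) = blinfun_apply (U t) x"
    by simp
  moreover have "blinfun_apply (U t) (blinfun_apply T x) = blinfun_apply (V t) x"
    using bounded_C0_group_inverse[OF U, of "-t"] by (simp add: T_def)
  ultimately show "blinfun_apply (U t) x = blinfun_apply (V t) x"
    by simp
qed

lemma exp_i_eq: "generates (scale_op \<i> A) U \<Longrightarrow> exp_i A = U"
  unfolding exp_i_def by (blast intro: the_equality generates_unique)

text \<open>
  Tuples are indexed by a finite linearly ordered type \<open>'n\<close>, whose elements in increasing order
  play the role of \<open>1, \<dots>, n\<close>.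
\<close>

definition weyl_tuple ::
  "real^'n^'n \<Rightarrow> ('n::finite \<Rightarrow> 'a::complex_banach unbounded_op) \<Rightarrow> bool" where
  "weyl_tuple \<Theta> A \<longleftrightarrow>
     (\<forall>k. \<exists>U. generates (scale_op \<i> (A k)) U) \<and>
     (\<forall>j k s t. exp_i (A j) t o\<^sub>L exp_i (A k) s =
        exp (\<i> * complex_of_real (\<Theta> $ j $ k * t * s)) *\<^sub>C (exp_i (A k) s o\<^sub>L exp_i (A j) t))"

definition upper :: "real^'n::{finite,linorder}^'n::{finite,linorder} \<Rightarrow>
     real^'n::{finite,linorder}^'n::{finite,linorder}" where
  "upper \<Theta> = (\<chi> j k. if j \<le> k then \<Theta> $ j $ k else 0)"

text \<open>
  \<open>weyl_exp \<Theta> A t\<close> is \<open>e\<^bsup>it\<cdot>A\<^esup>\<close>; the \<open>foldr\<close> composes the \<open>exp_i (A k) (t $ k)\<close> with \<open>k\<close> increasing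
  from left to right.
\<close>

definition weyl_exp ::
  "real^'n::{finite,linorder}^'n::{finite,linorder} \<Rightarrow> ('n \<Rightarrow> 'a::complex_banach unbounded_op) \<Rightarrow>
     real^'n::{finite,linorder} \<Rightarrow> 'a \<Rightarrow>\<^sub>L 'a" where
  "weyl_exp \<Theta> A t =
     exp (- (1/2) * \<i> * complex_of_real (t \<bullet> (upper \<Theta> *v t))) *\<^sub>C
     foldr (\<lambda>k T. exp_i (A k) (t $ k) o\<^sub>L T) (sorted_list_of_set UNIV) id_blinfun"

end

(* Moving each e^{i s_j A_j} to the left past the factors e^{i t_k A_k} with k > j turns the product
   of the two ordered products into the ordered product at t + s, with the phase
   sum_{j<k} Theta_kj t_k s_j = - <s, upper Theta t>.  Since Theta = upper Theta - transpose (upper Theta),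
   the half-phases in the definition of e^{it.A} symmetrise this to <t, Theta s> / 2.  Strong
   continuity of the ordered products follows from uniform boundedness of the groups. *)

theory Submission
  imports Defs
begin

section \<open>Complex scalars, complex-linear operators and strong continuity\<close>

lemma bounded_bilinear_scaleC:
  "bounded_bilinear ((*\<^sub>C) :: complex \<Rightarrow> 'a \<Rightarrow> 'a::complex_normed_vector)"
proof
  fix r :: real and a :: complex and x :: 'a
  show "(r *\<^sub>R a) *\<^sub>C x = r *\<^sub>R a *\<^sub>C x"
    by (simp only: scaleR_conv_of_real scaleC_scaleC[symmetric] scaleC_of_real)
  show "a *\<^sub>C r *\<^sub>R x = r *\<^sub>R a *\<^sub>C x"
    by (simp add: scaleC_of_real[symmetric] scaleC_scaleC mult.commute)
  show "\<exists>K. \<forall>a (x :: 'a). norm (a *\<^sub>C x) \<le> norm a * norm x * K"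
    by (rule exI[of _ 1]) (simp add: norm_scaleC)
qed (simp_all add: scaleC_add_left scaleC_add_right)

lemmas continuous_on_scaleC = bounded_bilinear.continuous_on[OF bounded_bilinear_scaleC]

lemma blinfun_compose_assoc: "(R o\<^sub>L S) o\<^sub>L T = R o\<^sub>L (S o\<^sub>L T)"
  by (rule blinfun_eqI) simp

lemma scaleC_compose_left: "(c *\<^sub>C S) o\<^sub>L T = c *\<^sub>C (S o\<^sub>L T)"
  by (rule blinfun_eqI) (simp add: scaleC_blinfun.rep_eq)

text \<open>A scalar in the right factor has to pass through \<open>S\<close>, so complex linearity
  of \<open>S\<close> enters here.\<close>

lemma scaleC_compose_right: "S \<in> bounded_ops \<Longrightarrow> S o\<^sub>L (c *\<^sub>C T) = c *\<^sub>C (S o\<^sub>L T)"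
  by (rule blinfun_eqI) (simp add: scaleC_blinfun.rep_eq bounded_ops_def)

lemma id_in_bounded_ops: "id_blinfun \<in> bounded_ops"
  by (simp add: bounded_ops_def)

lemma compose_in_bounded_ops: "S \<in> bounded_ops \<Longrightarrow> T \<in> bounded_ops \<Longrightarrow> S o\<^sub>L T \<in> bounded_ops"
  by (simp add: bounded_ops_def)

lemma scaleC_in_bounded_ops: "T \<in> bounded_ops \<Longrightarrow> c *\<^sub>C T \<in> bounded_ops"
  by (simp add: bounded_ops_def scaleC_blinfun.rep_eq scaleC_scaleC mult.commute)

lemma continuous_map_sot_iff:
  fixes F :: "'b::topological_space \<Rightarrow> 'a::complex_banach \<Rightarrow>\<^sub>L 'a"
  shows "continuous_map euclidean sot F \<longleftrightarrow>
    range F \<subseteq> bounded_ops \<and> (\<forall>x. continuous_on UNIV (\<lambda>t. blinfun_apply (F t) x))"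
  by (auto simp: sot_def continuous_map_in_subtopology
      continuous_on_strong_operator_topo_iff_coordinatewise)

lemma bounded_C0_group_in_bounded_ops: "bounded_C0_group U \<Longrightarrow> U t \<in> bounded_ops"
  by (auto simp: bounded_C0_group_def continuous_map_sot_iff)

text \<open>Near \<open>p\<close>, split the value into \<open>U (g t)\<close> applied to
  \<open>f t - f p\<close> and to \<open>f p\<close>. The uniform bound \<open>M\<close> of the
  group sends the first term to 0; the second runs along a single orbit, where strong continuity
  applies.\<close>

lemma bounded_C0_group_continuous_joint:
  assumes U: "bounded_C0_group U"
    and g: "continuous_on S g" and f: "continuous_on S f"
  shows "continuous_on S (\<lambda>t. blinfun_apply (U (g t)) (f t))"
  unfolding continuous_on_def
proof
  fix p assume p: "p \<in> S"
  obtain M where M: "\<And>t. norm (U t) \<le> M"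
    using U unfolding bounded_C0_group_def bounded_iff by auto
  have "continuous_on S (\<lambda>t. blinfun_apply (U (g t)) (f p))"
    using continuous_on_compose2[OF bounded_C0_group_continuous[OF U, of UNIV] g] by auto
  then have 1: "((\<lambda>t. blinfun_apply (U (g t)) (f p)) \<longlongrightarrow> blinfun_apply (U (g p)) (f p)) (at p within S)"
    using p by (simp add: continuous_on_def)
  have "((\<lambda>t. f t - f p) \<longlongrightarrow> 0) (at p within S)"
    using f p by (simp add: continuous_on_def LIM_zero)
  then have "((\<lambda>t. M * norm (f t - f p)) \<longlongrightarrow> 0) (at p within S)"
    by (intro tendsto_mult_right_zero tendsto_norm_zero)
  then have "((\<lambda>t. blinfun_apply (U (g t)) (f t - f p)) \<longlongrightarrow> 0) (at p within S)"
    by (rule Lim_null_comparison[rotated])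
      (intro always_eventually allI order_trans[OF norm_blinfun] mult_right_mono M norm_ge_zero)
  from tendsto_add[OF this 1]
  show "((\<lambda>t. blinfun_apply (U (g t)) (f t)) \<longlongrightarrow> blinfun_apply (U (g p)) (f p)) (at p within S)"
    by (simp add: blinfun.diff_right)
qed

section \<open>Reordering products of one-parameter groups\<close>

definition ordered_product ::
  "('k \<Rightarrow> real \<Rightarrow> 'a::complex_banach \<Rightarrow>\<^sub>L 'a) \<Rightarrow> 'k list \<Rightarrow> ('k \<Rightarrow> real) \<Rightarrow> 'a \<Rightarrow>\<^sub>L 'a" where
  "ordered_product U ks t = foldr (\<lambda>k T. U k (t k) o\<^sub>L T) ks id_blinfun"

lemma ordered_product_simps [simp]:
  "ordered_product U [] t = id_blinfun"
  "ordered_product U (k # ks) t = U k (t k) o\<^sub>L ordered_product U ks t"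
  by (simp_all add: ordered_product_def)

lemma ordered_product_in_bounded_ops:
  "(\<And>k t. U k t \<in> bounded_ops) \<Longrightarrow> ordered_product U ks t \<in> bounded_ops"
  by (induction ks) (simp_all add: id_in_bounded_ops compose_in_bounded_ops)

text \<open>In the induction the head group acts on the orbit of the tail, a vector that itself
  moves with \<open>p\<close>; this is why joint continuity is required.\<close>

lemma ordered_product_continuous:
  assumes U: "\<And>k. bounded_C0_group (U k)" and t: "\<And>k. continuous_on S (\<lambda>p. t p k)"
  shows "continuous_on S (\<lambda>p. blinfun_apply (ordered_product U ks (t p)) x)"
  by (induction ks) (simp_all add: bounded_C0_group_continuous_joint[OF U t])

text \<open>Each factor \<open>U k (t k)\<close> crossed by \<open>U j r\<close> contributes one
  commutation scalar, and the exponents add up along the list.\<close>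

lemma ordered_product_move:
  assumes lin: "\<And>k t. U k t \<in> bounded_ops"
    and comm: "\<And>j k t s. U j t o\<^sub>L U k s = exp (\<i> * complex_of_real (\<theta> j k * t * s)) *\<^sub>C (U k s o\<^sub>L U j t)"
  shows "ordered_product U ks t o\<^sub>L U j r =
    exp (\<i> * complex_of_real (\<Sum>k\<leftarrow>ks. \<theta> k j * t k * r)) *\<^sub>C (U j r o\<^sub>L ordered_product U ks t)"
proof (induction ks)
  case Nil
  show ?case
    by (simp add: blinfun_eqI)
next
  case (Cons k ks)
  let ?P = "ordered_product U ks t"
  let ?c = "exp (\<i> * complex_of_real (\<Sum>k\<leftarrow>ks. \<theta> k j * t k * r))"
  let ?d = "exp (\<i> * complex_of_real (\<theta> k j * t k * r))"
  have "ordered_product U (k # ks) t o\<^sub>L U j r = U k (t k) o\<^sub>L (?P o\<^sub>L U j r)"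
    by (simp add: blinfun_compose_assoc)
  also have "\<dots> = ?c *\<^sub>C ((U k (t k) o\<^sub>L U j r) o\<^sub>L ?P)"
    by (simp add: Cons.IH scaleC_compose_right lin blinfun_compose_assoc)
  also have "\<dots> = (?c * ?d) *\<^sub>C (U j r o\<^sub>L (U k (t k) o\<^sub>L ?P))"
    by (simp add: comm[of k] scaleC_compose_left scaleC_scaleC blinfun_compose_assoc)
  also have "?c * ?d = exp (\<i> * complex_of_real (\<Sum>k\<leftarrow>k # ks. \<theta> k j * t k * r))"
    by (simp add: exp_add[symmetric] algebra_simps)
  finally show ?case
    by simp
qed

text \<open>With head \<open>j\<close>, the factor \<open>U j (s j)\<close> crosses the tail product
  at \<open>t\<close> and merges with \<open>U j (t j)\<close>, leaving the product of the two tails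
  to the induction. As the list increases strictly, the crossed pairs are exactly those with
  \<open>j < k\<close>. A double sum over sets becomes a bilinear form once the list exhausts the
  indices.\<close>

lemma ordered_product_mult:
  fixes ks :: "'k::linorder list"
  assumes lin: "\<And>k t. U k t \<in> bounded_ops"
    and comm: "\<And>j k t s. U j t o\<^sub>L U k s = exp (\<i> * complex_of_real (\<theta> j k * t * s)) *\<^sub>C (U k s o\<^sub>L U j t)"
    and add: "\<And>k t s. U k (t + s) = U k t o\<^sub>L U k s"
    and ks: "sorted_wrt (<) ks"
  shows "ordered_product U ks t o\<^sub>L ordered_product U ks s =
    exp (\<i> * complex_of_real (\<Sum>j\<in>set ks. \<Sum>k\<in>set ks. if j < k then \<theta> k j * t k * s j else 0)) *\<^sub>C
      ordered_product U ks (\<lambda>k. t k + s k)"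
  using ks
proof (induction ks)
  case Nil
  show ?case
    by (simp add: blinfun_eqI)
next
  case (Cons j ks)
  define f where "f j k = (if j < k then \<theta> k j * t k * s j else 0)" for j k
  let ?P = "ordered_product U ks"
  let ?c = "exp (\<i> * complex_of_real (\<Sum>k\<leftarrow>ks. \<theta> k j * t k * s j))"
  let ?d = "exp (\<i> * complex_of_real (\<Sum>j\<in>set ks. \<Sum>k\<in>set ks. f j k))"
  have less: "j < k" if "k \<in> set ks" for k
    using Cons.prems that by simp
  have "distinct ks"
    using Cons.prems by (simp add: strict_sorted_iff)
  \<comment> \<open>The new index \<open>j\<close> adds a row and a column to the double sum. The
    row is the phase of the crossing; the column and the diagonal entry vanish because
    \<open>j\<close> lies below every index of the tail.\<close>
  have "(\<Sum>k\<leftarrow>ks. \<theta> k j * t k * s j) = (\<Sum>k\<in>set ks. f j k)"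
    using \<open>distinct ks\<close> less by (simp add: sum_list_distinct_conv_sum_set f_def)
  moreover have "f i j = 0" if "i \<in> set ks" for i
    using less[OF that] by (simp add: f_def)
  moreover have "f j j = 0" "j \<notin> set ks"
    using less by (auto simp: f_def)
  ultimately have phase: "(\<Sum>i\<in>set (j # ks). \<Sum>k\<in>set (j # ks). f i k) =
      (\<Sum>k\<leftarrow>ks. \<theta> k j * t k * s j) + (\<Sum>i\<in>set ks. \<Sum>k\<in>set ks. f i k)"
    by simp
  have "ordered_product U (j # ks) t o\<^sub>L ordered_product U (j # ks) s =
      U j (t j) o\<^sub>L ((?P t o\<^sub>L U j (s j)) o\<^sub>L ?P s)"
    by (simp add: blinfun_compose_assoc)
  also have "\<dots> = ?c *\<^sub>C (U j (t j) o\<^sub>L (U j (s j) o\<^sub>L (?P t o\<^sub>L ?P s)))"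
    by (simp add: ordered_product_move[where \<theta> = \<theta>, OF lin comm] scaleC_compose_left
        scaleC_compose_right lin blinfun_compose_assoc)
  also have "?P t o\<^sub>L ?P s = ?d *\<^sub>C ?P (\<lambda>k. t k + s k)"
    using Cons by (simp add: f_def)
  also have "?c *\<^sub>C (U j (t j) o\<^sub>L (U j (s j) o\<^sub>L ?d *\<^sub>C ?P (\<lambda>k. t k + s k))) =
      (?c * ?d) *\<^sub>C ordered_product U (j # ks) (\<lambda>k. t k + s k)"
    by (simp add: scaleC_compose_right lin scaleC_scaleC add blinfun_compose_assoc)
  also have "?c * ?d = exp (\<i> * complex_of_real (\<Sum>i\<in>set (j # ks). \<Sum>k\<in>set (j # ks). f i k))"
    unfolding phase by (simp add: exp_add[symmetric] algebra_simps)
  finally show ?case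
    by (simp only: f_def)
qed

section \<open>Phases as bilinear forms of the upper triangular part\<close>

lemma inner_matrix_vector_mult:
  fixes M :: "real^'n^'n"
  shows "s \<bullet> (M *v t) = (\<Sum>j\<in>UNIV. \<Sum>k\<in>UNIV. s $ j * M $ j $ k * t $ k)"
  by (simp add: inner_vec_def matrix_vector_mult_def sum_distrib_left mult.assoc)

lemma skew_entry:
  fixes \<Theta> :: "real^'n^'n"
  assumes "transpose \<Theta> = - \<Theta>"
  shows "\<Theta> $ k $ j = - \<Theta> $ j $ k"
proof -
  have "transpose \<Theta> $ j $ k = (- \<Theta>) $ j $ k"
    by (simp add: assms)
  then show ?thesis
    by (simp add: transpose_def)
qed

text \<open>Below the diagonal, skew symmetry supplies the sign. Although \<open>upper\<close> keeps
  the diagonal, both sides vanish there.\<close>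

lemma skew_eq_upper:
  assumes "transpose \<Theta> = - \<Theta>"
  shows "\<Theta> = upper \<Theta> - transpose (upper \<Theta>)"
proof -
  have "\<Theta> $ j $ k = (upper \<Theta> - transpose (upper \<Theta>)) $ j $ k" for j k
    using skew_entry[OF assms, of k j] by (auto simp: upper_def transpose_def)
  then show ?thesis
    by (simp add: vec_eq_iff)
qed

text \<open>Up to the factor 1/2, this equates the exponents on the two sides of the Weyl relation.
  Splitting \<Theta> by \<open>skew_eq_upper\<close> cancels one mixed term of the form at
  \<open>t + s\<close> and doubles the other.\<close>

lemma weyl_exp_phase:
  assumes skew: "transpose \<Theta> = - \<Theta>"
  shows "t \<bullet> (\<Theta> *v s) - (t + s) \<bullet> (upper \<Theta> *v (t + s)) =
    - (t \<bullet> (upper \<Theta> *v t)) - s \<bullet> (upper \<Theta> *v s) - 2 * (s \<bullet> (upper \<Theta> *v t))"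
proof -
  have "t \<bullet> (\<Theta> *v s) = t \<bullet> (upper \<Theta> *v s) - t \<bullet> (transpose (upper \<Theta>) *v s)"
    by (subst skew_eq_upper[OF skew]) (simp add: matrix_vector_mult_diff_rdistrib inner_diff_right)
  also have "t \<bullet> (transpose (upper \<Theta>) *v s) = s \<bullet> (upper \<Theta> *v t)"
    by (simp add: dot_lmul_matrix[symmetric] inner_commute)
  finally show ?thesis
    by (simp add: matrix_vector_right_distrib inner_add_left inner_add_right)
qed

text \<open>Identifies the crossing phase of \<open>ordered_product_mult\<close>. The strict
  inequality agrees with the non-strict one in \<open>upper\<close> because a skew matrix has zero
  diagonal.\<close>

lemma upper_phase:
  assumes skew: "transpose \<Theta> = - \<Theta>"
  shows "(\<Sum>j\<in>UNIV. \<Sum>k\<in>UNIV. if j < k then \<Theta> $ k $ j * t $ k * s $ j else 0) =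
    - (s \<bullet> (upper \<Theta> *v t))"
proof -
  have "(if j < k then \<Theta> $ k $ j * t $ k * s $ j else 0) = - (s $ j * upper \<Theta> $ j $ k * t $ k)" for j k
    using skew_entry[OF skew, of k j] by (cases j k rule: linorder_cases) (auto simp: upper_def)
  then show ?thesis
    by (simp add: inner_matrix_vector_mult sum_negf)
qed

theorem lemma2p1p4:
  fixes \<Theta> :: "real^'n::{finite,linorder}^'n::{finite,linorder}"
    and A :: "'n \<Rightarrow> 'a::complex_banach unbounded_op"
  assumes skew: "transpose \<Theta> = - \<Theta>"
    and weyl: "weyl_tuple \<Theta> A"
  shows "(\<forall>t s. weyl_exp \<Theta> A t o\<^sub>L weyl_exp \<Theta> A s =
            exp (1/2 * \<i> * complex_of_real (t \<bullet> (\<Theta> *v s))) *\<^sub>C weyl_exp \<Theta> A (t + s)) \<and>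
         continuous_map euclidean sot (weyl_exp \<Theta> A)"
proof (intro conjI allI)
  define U where "U = (\<lambda>k. exp_i (A k))"
  define ks where "ks = sorted_list_of_set (UNIV :: 'n set)"
  define q where "q t = t \<bullet> (upper \<Theta> *v t)" for t
  \<comment> \<open>\<open>exp_i\<close> is a definite description; uniqueness of the generated
    group, through \<open>exp_i_eq\<close>, identifies it with the witness \<open>V\<close>.\<close>
  have group: "bounded_C0_group (U k)" for k
  proof -
    obtain V where V: "generates (scale_op \<i> (A k)) V"
      using weyl unfolding weyl_tuple_def by blast
    then show ?thesis
      by (simp add: U_def exp_i_eq[OF V] generates_def)
  qed
  have lin: "U k t \<in> bounded_ops" for k t
    by (rule bounded_C0_group_in_bounded_ops[OF group])
  have comm: "U j t o\<^sub>L U k s = exp (\<i> * complex_of_real (\<Theta> $ j $ k * t * s)) *\<^sub>C (U k s o\<^sub>L U j t)"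
    for j k t s
    using weyl unfolding weyl_tuple_def U_def by blast
  have add: "U k (t + s) = U k t o\<^sub>L U k s" for k t s
    using group by (simp add: bounded_C0_group_def)
  have ks: "sorted_wrt (<) ks" "set ks = UNIV"
    by (simp_all add: ks_def)
  have weyl_exp: "weyl_exp \<Theta> A t = exp (- (1/2) * \<i> * complex_of_real (q t)) *\<^sub>C ordered_product U ks (($) t)" for t
    by (simp add: weyl_exp_def ordered_product_def U_def ks_def q_def)
  show "weyl_exp \<Theta> A t o\<^sub>L weyl_exp \<Theta> A s =
      exp (1/2 * \<i> * complex_of_real (t \<bullet> (\<Theta> *v s))) *\<^sub>C weyl_exp \<Theta> A (t + s)" for t s
  proof -
    let ?b = "s \<bullet> (upper \<Theta> *v t)"
    have "($) (t + s) = (\<lambda>k. t $ k + s $ k)"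
      by (simp add: fun_eq_iff)
    then have "ordered_product U ks (($) t) o\<^sub>L ordered_product U ks (($) s) =
        exp (\<i> * complex_of_real (- ?b)) *\<^sub>C ordered_product U ks (($) (t + s))"
      using ordered_product_mult[where \<theta> = "\<lambda>j k. \<Theta> $ j $ k", OF lin comm add ks(1), of "($) t" "($) s"]
        upper_phase[OF skew, of t s]
      by (simp add: ks(2))
    then have "weyl_exp \<Theta> A t o\<^sub>L weyl_exp \<Theta> A s =
        (exp (- (1/2) * \<i> * complex_of_real (q t)) * exp (- (1/2) * \<i> * complex_of_real (q s)) *
          exp (\<i> * complex_of_real (- ?b))) *\<^sub>C ordered_product U ks (($) (t + s))"
      by (simp add: weyl_exp scaleC_compose_left scaleC_compose_right
          ordered_product_in_bounded_ops lin scaleC_scaleC mult.assoc)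
    \<comment> \<open>Taking out the common factor 1/2 puts the 2 in front of
      \<open>?b\<close>.\<close>
    also have "exp (- (1/2) * \<i> * complex_of_real (q t)) * exp (- (1/2) * \<i> * complex_of_real (q s)) *
          exp (\<i> * complex_of_real (- ?b)) = exp (1/2 * \<i> * complex_of_real (- q t - q s - 2 * ?b))"
      unfolding exp_add[symmetric] by (rule arg_cong[of _ _ exp]) (simp add: algebra_simps)
    \<comment> \<open>The exponent is now the desired phase minus \<open>q (t + s)\<close>, whose
      half is the normalisation built into \<open>weyl_exp\<close> at \<open>t + s\<close>.\<close>
    also have "- q t - q s - 2 * ?b = t \<bullet> (\<Theta> *v s) - q (t + s)"
      using weyl_exp_phase[OF skew, of t s] by (simp add: q_def)
    also have "exp (1/2 * \<i> * complex_of_real (t \<bullet> (\<Theta> *v s) - q (t + s))) =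
        exp (1/2 * \<i> * complex_of_real (t \<bullet> (\<Theta> *v s))) * exp (- (1/2) * \<i> * complex_of_real (q (t + s)))"
      unfolding exp_add[symmetric] by (rule arg_cong[of _ _ exp]) (simp add: algebra_simps)
    finally show ?thesis
      by (simp only: weyl_exp scaleC_scaleC)
  qed
  show "continuous_map euclidean sot (weyl_exp \<Theta> A)"
    unfolding continuous_map_sot_iff
  proof (intro conjI allI)
    show "range (weyl_exp \<Theta> A) \<subseteq> bounded_ops"
      by (auto simp: weyl_exp intro!: scaleC_in_bounded_ops ordered_product_in_bounded_ops lin)
    fix x
    have "continuous_on UNIV q"
      unfolding q_def by (intro continuous_intros matrix_vector_mult_linear_continuous_on)
    then have "continuous_on UNIV (\<lambda>t. exp (- (1/2) * \<i> * complex_of_real (q t)))"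
      by (intro continuous_intros)
    moreover have "continuous_on UNIV (\<lambda>t. blinfun_apply (ordered_product U ks (($) t)) x)"
      by (intro ordered_product_continuous group continuous_intros)
    ultimately show "continuous_on UNIV (\<lambda>t. blinfun_apply (weyl_exp \<Theta> A t) x)"
      unfolding weyl_exp scaleC_blinfun.rep_eq by (rule continuous_on_scaleC)
  qed
qed

end
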